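(* Let $\{\Theta^t\}_{t\in\mathbb{R}_+}$ be a birth-and-growth process in $\mathbb{R}^d$, $d\ge 2$, belonging to the class $\mathcal{G}$. Then for every $x\in\mathbb{R}^d$ the time of capture $$T(x):=\min\{t>0\,:\,x\in\Theta^t\}$$ admits a probability density function, i.e. the law $P^x(A):=\mathbb{P}(T(x)\in A)$, $A\subset\mathbb{R}$ Borel, is absolutely continuous with respect to the one-dimensional Lebesgue measure.
   Context: Throughout $d\ge2$, $\mathbb{R}_+=[0,\infty)$, $\mathcal{H}^n$ is $n$-dimensional Hausdorff measure, and $\mathcal{H}^d$ is Lebesgue measure on $\mathbb{R}^d$. All random objects live on one probability space $(\Omega,\mathfrak{F},\mathbb{P})$. Nucleation process. $N=\sum_{j\ge1}\delta_{(T_j,X_j)}$ is a marked point process in $\mathbb{R}_+$ with marks in $\mathbb{R}^d$: $T_j\ge 0$ is the random birth time and $X_j$ the random location of the $j$-th nucleus. The marginal process is $\widetilde N(\cdot):=N(\,\cdot\times\mathbb{R}^d)$. The intensity measures are $\Lambda(B\times A):=\mathbb{E}[N(B\times A)]$ and $\widetilde\Lambda(B):=\mathbb{E}[\widetilde N(B)]$, with the decomposition $\Lambda(dt\times dx)=\widetilde\Lambda(dt)\,Q(t,dx)$, where $Q(t,\cdot)$ is a probability measure on $\mathbb{R}^d$ for each $t$ (the mark distribution at time $t$). Growth model. For $t\ge s$, $\Theta_s^t(y)$ denotes the grain (closed set) grown up to time $t$ from a nucleus born at time $s$ at the point $y$; $\Theta_s^t(y)=\emptyset$ for $t<s$. The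 normal growth model is assumed: at $\mathcal{H}^{d-1}$-a.e. point $x\in\partial\Theta_{s}^t(y)$ growth occurs with normal velocity $v(t,x)=G(t,x)n(t,x)$, where $n(t,x)$ is the unit outer normal to the grain at $x$ and $G$ is a given deterministic growth field with $0<g_0\le G(t,x)\le G_0<\infty$ for all $(t,x)\in\mathbb{R}_+\times\mathbb{R}^d$ (constants $g_0,G_0$). $G$ is assumed sufficiently regular that the evolution problem for the growth front $\partial\Theta_{s}^t(y)$ is well posed; in particular the grains are random closed sets whose boundaries have locally finite $\mathcal{H}^{d-1}$-measure a.s., the causal cone $$\mathcal{C}(t,x):=\{(s,y)\in[0,t]\times\mathbb{R}^d:\ x\in\Theta_s^t(y)\}$$ is well defined for all $(t,x)$, and (as a known property of the growth model) $t\mapsto\Lambda(\mathcal{C}(t,x))$ is continuously differentiable whenever $\Lambda\ll\mathcal{H}^1\times\mathcal{H}^d$. Birth-and-growth process: the family of random closed sets $\Theta^t:=\bigcup_{T_j\le t}\Theta_{T_j}^t(X_j)$, $t\in\mathbb{R}_+$. Class $\mathcal{G}$: the family of all birth-and-growth processes $\{\Theta^t\}_t$ with growth model as described such that: (i) for every $t\in\mathbb{R}_+$ and every bounded Borel set $A\subset\mathbb{R}^d$ with $\mathcal{H}^d(\partial A)=0$, $$\lim_{r\downarrow0}\frac{\mathbb{E}[\mathcal{H}^d((\Theta^t_r\setminus\Theta^t)\cap A)]}{r}=\mathbb{E}[\mathcal{H}^{d-1}(\partial\Theta^t\cap A)],$$ where $\Theta^t_r:=\{x\in\mathbb{R}^d:\exists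 y\in\Theta^t,\ |x-y|\le r\}$; (A1) $\mathbb{E}\big[\widetilde N([t,t+\Delta t])\,\mathbf{1}_{\{\widetilde N([t,t+\Delta t])\ge2\}}\big]=o(\Delta t)$ as $\Delta t\downarrow 0$, for all $t>0$; (A2) $\widetilde\Lambda$ is locally finite and has a density $\lambda$ with respect to Lebesgue measure, and for all $t>0$ the mark distribution $Q(t,\cdot)$ has a density $q(t,\cdot)$ on $\mathbb{R}^d$ with respect to $\mathcal{H}^d$. Convention: $T(x)=+\infty$ if $x$ is never captured; the law $P^x$ is considered on Borel subsets of $\mathbb{R}$. *)

theory Defs
  imports "HOL-Probability.Probability"
begin

text \<open>The normalisation by the volume of the unit ball makes the \<open>d\<close>-dimensional measure on
  \<open>d\<close>-dimensional Euclidean space equal to Lebesgue measure.  The covering sets must be required to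
  be bounded, since \<^const>\<open>diameter\<close> carries no information about unbounded sets.  This is an outer
  measure on all sets; below it is applied to Borel sets and in statements about null sets.\<close>

definition hausdorff_measure :: "nat \<Rightarrow> 'a::metric_space set \<Rightarrow> ennreal" where
  "hausdorff_measure k A =
     (SUP \<delta>\<in>{0<..}.
        INF U\<in>{U :: nat \<Rightarrow> 'a set. A \<subseteq> (\<Union>i. U i) \<and> (\<forall>i. bounded (U i) \<and> diameter (U i) \<le> \<delta>)}.
          \<Sum>i. if U i = {} then 0
               else ennreal (unit_ball_vol (real k) * (diameter (U i) / 2) ^ k))"

text \<open>Exterior unit normal in the measure-theoretic sense of Federer: after blow-up at \<open>x\<close> the set
  \<open>F\<close> is the half-space opposite to \<open>n\<close>.\<close>

definition outer_unit_normal :: "(real^'n) set \<Rightarrow> real^'n \<Rightarrow> real^'n \<Rightarrow> bool" where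
  "outer_unit_normal F x n \<longleftrightarrow> norm n = 1 \<and>
     ((\<lambda>r. measure lborel {z \<in> ball x r. z \<in> F \<and> 0 < (z - x) \<bullet> n} / r ^ CARD('n)) \<longlongrightarrow> 0) (at_right 0) \<and>
     ((\<lambda>r. measure lborel {z \<in> ball x r. z \<notin> F \<and> (z - x) \<bullet> n < 0} / r ^ CARD('n)) \<longlongrightarrow> 0) (at_right 0)"

text \<open>The front of the evolving set \<open>F\<close> passes through \<open>x\<close> at time \<open>t\<close> with velocity vector \<open>v\<close>:
  some point that stays on the front has right derivative \<open>v\<close> at time \<open>t\<close>.\<close>

definition front_velocity :: "(real \<Rightarrow> (real^'n) set) \<Rightarrow> real \<Rightarrow> real^'n \<Rightarrow> real^'n \<Rightarrow> bool" where
  "front_velocity F t x v \<longleftrightarrow>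
     (\<exists>\<gamma> :: real \<Rightarrow> real^'n. \<gamma> t = x \<and> (\<forall>\<^sub>F u in at_right t. \<gamma> u \<in> frontier (F u)) \<and>
        (\<gamma> has_vector_derivative v) (at t within {t..}))"

definition random_closed_set :: "'w measure \<Rightarrow> ('w \<Rightarrow> (real^'n) set) \<Rightarrow> bool" where
  "random_closed_set M F \<longleftrightarrow> (AE \<omega> in M. closed (F \<omega>)) \<and>
     (\<forall>K. compact K \<longrightarrow> {\<omega> \<in> space M. F \<omega> \<inter> K \<noteq> {}} \<in> sets M)"

definition parallel_set :: "real \<Rightarrow> (real^'n) set \<Rightarrow> (real^'n) set" where
  "parallel_set r S = {x. \<exists>y\<in>S. norm (x - y) \<le> r}"

definition continuously_differentiable_on_Rplus :: "(real \<Rightarrow> real) \<Rightarrow> bool" where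
  "continuously_differentiable_on_Rplus f \<longleftrightarrow>
     (\<exists>f'. continuous_on {0..} f' \<and> (\<forall>t\<ge>0. (f has_real_derivative f' t) (at t within {0..})))"

text \<open>\<open>T j\<close> and \<open>X j\<close> are the birth time and the location of the \<open>j\<close>-th nucleus; \<open>T j \<omega> = \<infinity>\<close> means
  that there is no \<open>j\<close>-th nucleus, so that realisations with finitely many nuclei are included.\<close>

locale nucleation_process = prob_space M
  for M :: "'w measure" +
  fixes T :: "nat \<Rightarrow> 'w \<Rightarrow> ereal" and X :: "nat \<Rightarrow> 'w \<Rightarrow> real^'n"
  assumes T_measurable: "\<And>j. random_variable borel (T j)"
    and X_measurable: "\<And>j. random_variable borel (X j)"
    and T_nonneg: "\<And>j \<omega>. \<omega> \<in> space M \<Longrightarrow> 0 \<le> T j \<omega>"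

definition N_count :: "(nat \<Rightarrow> 'w \<Rightarrow> ereal) \<Rightarrow> (nat \<Rightarrow> 'w \<Rightarrow> real^'n) \<Rightarrow> 'w \<Rightarrow> (real \<times> (real^'n)) set \<Rightarrow> ennreal"
  where "N_count T X \<omega> C =
     (\<Sum>j. if T j \<omega> < \<infinity> then indicator C (real_of_ereal (T j \<omega>), X j \<omega>) else 0)"

definition N_marginal :: "(nat \<Rightarrow> 'w \<Rightarrow> ereal) \<Rightarrow> (nat \<Rightarrow> 'w \<Rightarrow> real^'n) \<Rightarrow> 'w \<Rightarrow> real set \<Rightarrow> ennreal"
  where "N_marginal T X \<omega> B = N_count T X \<omega> (B \<times> UNIV)"

text \<open>The set functions below are countably additive on Borel sets because the birth times and
  locations are measurable, so \<^const>\<open>measure_of\<close> returns them unchanged.\<close>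

definition intensity ::
  "'w measure \<Rightarrow> (nat \<Rightarrow> 'w \<Rightarrow> ereal) \<Rightarrow> (nat \<Rightarrow> 'w \<Rightarrow> real^'n) \<Rightarrow> (real \<times> (real^'n)) measure" where
  "intensity M T X = measure_of UNIV (sets borel) (\<lambda>C. \<integral>\<^sup>+\<omega>. N_count T X \<omega> C \<partial>M)"

definition marginal_intensity ::
  "'w measure \<Rightarrow> (nat \<Rightarrow> 'w \<Rightarrow> ereal) \<Rightarrow> (nat \<Rightarrow> 'w \<Rightarrow> real^'n) \<Rightarrow> real measure" where
  "marginal_intensity M T X = measure_of UNIV (sets borel) (\<lambda>B. \<integral>\<^sup>+\<omega>. N_marginal T X \<omega> B \<partial>M)"

locale nucleation_process_with_marks = nucleation_process M T X
  for M :: "'w measure" and T :: "nat \<Rightarrow> 'w \<Rightarrow> ereal" and X :: "nat \<Rightarrow> 'w \<Rightarrow> real^'n" +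
  fixes Q :: "real \<Rightarrow> (real^'n) measure"
  assumes Q_kernel: "Q \<in> measurable (restrict_space borel {0..}) (prob_algebra borel)"
    and intensity_decomposition:
      "\<And>A B. A \<in> sets borel \<Longrightarrow> B \<in> sets borel \<Longrightarrow> B \<subseteq> {0..} \<Longrightarrow>
         emeasure (intensity M T X) (B \<times> A) =
           (\<integral>\<^sup>+t\<in>B. emeasure (Q t) A \<partial>marginal_intensity M T X)"

text \<open>\<open>Gr s t y\<close> is the grain at time \<open>t\<close> grown from the nucleus born at time \<open>s\<close> at the point \<open>y\<close>.
  No regularity class is fixed for the growth field \<open>G\<close>: what its regularity is there to provide is
  assumed directly, here and in the next locale.  That grains only grow in time expresses that the
  front moves outwards.\<close>

locale growth_model =
  fixes G :: "real \<Rightarrow> real^'n \<Rightarrow> real" and g0 G0 :: real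
    and Gr :: "real \<Rightarrow> real \<Rightarrow> real^'n \<Rightarrow> (real^'n) set"
  assumes g0_pos: "0 < g0"
    and G_bounds: "\<And>t x. 0 \<le> t \<Longrightarrow> g0 \<le> G t x \<and> G t x \<le> G0"
    and grain_before: "\<And>s t y. 0 \<le> s \<Longrightarrow> t < s \<Longrightarrow> Gr s t y = {}"
    and grain_birth: "\<And>s y. 0 \<le> s \<Longrightarrow> Gr s s y = {y}"
    and grain_closed: "\<And>s t y. 0 \<le> s \<Longrightarrow> closed (Gr s t y)"
    and grain_mono: "\<And>s t u y. 0 \<le> s \<Longrightarrow> s \<le> t \<Longrightarrow> t \<le> u \<Longrightarrow> Gr s t y \<subseteq> Gr s u y"
    and normal_growth: "\<And>s t y. 0 \<le> s \<Longrightarrow> s \<le> t \<Longrightarrow>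
      hausdorff_measure (CARD('n) - 1)
        {x \<in> frontier (Gr s t y).
           \<not> (\<exists>n. outer_unit_normal (Gr s t y) x n \<and>
                  front_velocity (\<lambda>u. Gr s u y) t x (G t x *\<^sub>R n))} = 0"

definition causal_cone ::
  "(real \<Rightarrow> real \<Rightarrow> real^'n \<Rightarrow> (real^'n) set) \<Rightarrow> real \<Rightarrow> real^'n \<Rightarrow> (real \<times> (real^'n)) set" where
  "causal_cone Gr t x = {(s, y). 0 \<le> s \<and> s \<le> t \<and> x \<in> Gr s t y}"

definition nucleus_grain ::
  "(nat \<Rightarrow> 'w \<Rightarrow> ereal) \<Rightarrow> (nat \<Rightarrow> 'w \<Rightarrow> real^'n) \<Rightarrow>
   (real \<Rightarrow> real \<Rightarrow> real^'n \<Rightarrow> (real^'n) set) \<Rightarrow> nat \<Rightarrow> real \<Rightarrow> 'w \<Rightarrow> (real^'n) set" where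
  "nucleus_grain T X Gr j t \<omega> =
     (if T j \<omega> \<le> ereal t then Gr (real_of_ereal (T j \<omega>)) t (X j \<omega>) else {})"

definition crystal ::
  "(nat \<Rightarrow> 'w \<Rightarrow> ereal) \<Rightarrow> (nat \<Rightarrow> 'w \<Rightarrow> real^'n) \<Rightarrow>
   (real \<Rightarrow> real \<Rightarrow> real^'n \<Rightarrow> (real^'n) set) \<Rightarrow> real \<Rightarrow> 'w \<Rightarrow> (real^'n) set" where
  "crystal T X Gr t \<omega> = (\<Union>j\<in>{j. T j \<omega> \<le> ereal t}. Gr (real_of_ereal (T j \<omega>)) t (X j \<omega>))"

text \<open>The last assumption concerns only the intensity measure of the process at hand; it would be
  false if demanded for all absolutely continuous measures.\<close>

locale birth_and_growth =
  nucleation_process_with_marks M T X Q + growth_model G g0 G0 Gr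
  for M :: "'w measure" and T :: "nat \<Rightarrow> 'w \<Rightarrow> ereal" and X :: "nat \<Rightarrow> 'w \<Rightarrow> real^'n"
    and Q :: "real \<Rightarrow> (real^'n) measure"
    and G :: "real \<Rightarrow> real^'n \<Rightarrow> real" and g0 G0 :: real
    and Gr :: "real \<Rightarrow> real \<Rightarrow> real^'n \<Rightarrow> (real^'n) set" +
  assumes grain_random: "\<And>j t. 0 \<le> t \<Longrightarrow> random_closed_set M (nucleus_grain T X Gr j t)"
    and grain_boundary: "\<And>j t. 0 \<le> t \<Longrightarrow>
      AE \<omega> in M. \<forall>K. compact K \<longrightarrow>
        hausdorff_measure (CARD('n) - 1) (frontier (nucleus_grain T X Gr j t \<omega>) \<inter> K) < \<infinity>"
    and crystal_random: "\<And>t. 0 \<le> t \<Longrightarrow> random_closed_set M (crystal T X Gr t)"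
    and cone_measurable: "\<And>t x. 0 \<le> t \<Longrightarrow> causal_cone Gr t x \<in> sets borel"
    and cone_C1: "absolutely_continuous (lborel \<Otimes>\<^sub>M lborel) (intensity M T X) \<Longrightarrow>
      continuously_differentiable_on_Rplus (\<lambda>t. measure (intensity M T X) (causal_cone Gr t x))"

locale class_G = birth_and_growth M T X Q G g0 G0 Gr
  for M :: "'w measure" and T :: "nat \<Rightarrow> 'w \<Rightarrow> ereal" and X :: "nat \<Rightarrow> 'w \<Rightarrow> real^'n"
    and Q :: "real \<Rightarrow> (real^'n) measure"
    and G :: "real \<Rightarrow> real^'n \<Rightarrow> real" and g0 G0 :: real
    and Gr :: "real \<Rightarrow> real \<Rightarrow> real^'n \<Rightarrow> (real^'n) set" +
  assumes mean_outer_Minkowski: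
    "\<And>t A. 0 \<le> t \<Longrightarrow> A \<in> sets borel \<Longrightarrow> bounded A \<Longrightarrow> emeasure lborel (frontier A) = 0 \<Longrightarrow>
       ((\<lambda>r. (\<integral>\<^sup>+\<omega>. emeasure lborel
                  ((parallel_set r (crystal T X Gr t \<omega>) - crystal T X Gr t \<omega>) \<inter> A) \<partial>M) / ennreal r)
         \<longlongrightarrow> (\<integral>\<^sup>+\<omega>. hausdorff_measure (CARD('n) - 1) (frontier (crystal T X Gr t \<omega>) \<inter> A) \<partial>M))
       (at_right 0)"
    and A1: "\<And>t. 0 < t \<Longrightarrow>
       ((\<lambda>h. (\<integral>\<^sup>+\<omega>. N_marginal T X \<omega> {t..t + h} *
                  indicator {\<omega>. N_marginal T X \<omega> {t..t + h} \<ge> 2} \<omega> \<partial>M) / ennreal h)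
         \<longlongrightarrow> 0) (at_right 0)"
    and A2_locally_finite: "\<And>K. compact K \<Longrightarrow> emeasure (marginal_intensity M T X) K < \<infinity>"
    and A2_time_density: "\<exists>l \<in> borel_measurable borel. (\<forall>t. 0 \<le> l t) \<and>
       marginal_intensity M T X = density lborel (\<lambda>t. ennreal (l t))"
    and A2_mark_density: "\<And>t. 0 < t \<Longrightarrow> \<exists>q \<in> borel_measurable borel. (\<forall>y. 0 \<le> q y) \<and>
       Q t = density lborel (\<lambda>y. ennreal (q y))"

text \<open>The infimum in the extended reals is the minimum whenever the latter exists, and it is
  \<open>\<infinity>\<close> if \<open>x\<close> is never captured.\<close>

definition capture_time ::
  "(nat \<Rightarrow> 'w \<Rightarrow> ereal) \<Rightarrow> (nat \<Rightarrow> 'w \<Rightarrow> real^'n) \<Rightarrow>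
   (real \<Rightarrow> real \<Rightarrow> real^'n \<Rightarrow> (real^'n) set) \<Rightarrow> real^'n \<Rightarrow> 'w \<Rightarrow> ereal" where
  "capture_time T X Gr x \<omega> = Inf (ereal ` {t. 0 < t \<and> x \<in> crystal T X Gr t \<omega>})"

text \<open>For \<open>Y\<close> with values in \<open>(-\<infinity>, \<infinity>]\<close>, the measure on the real line that sends a Borel set \<open>A\<close> to
  the probability of \<open>Y \<in> A\<close>.  Its total mass is the probability that \<open>Y\<close> is finite.\<close>

definition real_law :: "'w measure \<Rightarrow> ('w \<Rightarrow> ereal) \<Rightarrow> real measure" where
  "real_law M Y = distr (restrict_space M {\<omega>. Y \<omega> < \<infinity>}) borel (\<lambda>\<omega>. real_of_ereal (Y \<omega>))"

end

theory Submission
  imports Defs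
begin

text \<open>Fix a point \<open>x\<close> and let \<open>F t\<close> be the intensity of the causal cone of \<open>(t, x)\<close>, that is, the
  expected number of nuclei whose grain has reached \<open>x\<close> by time \<open>t\<close>.  If \<open>x\<close> is captured after
  time \<open>a\<close> and no later than \<open>b\<close>, then for every \<open>u > b\<close> the crystal contains \<open>x\<close> at time \<open>u\<close> but not
  at time \<open>a\<close>, so some nucleus lies in the cone of \<open>(u, x)\<close> and outside the cone of \<open>(a, x)\<close>.  By
  Markov's inequality for the number of such nuclei, the probability of capture in \<open>(a, b]\<close> is at most
  \<open>F u - F a\<close>, and letting \<open>u\<close> decrease to \<open>b\<close> bounds it by \<open>F b - F a\<close>
  (\<open>measure_law_Ioc_le\<close>).  Passing through \<open>u > b\<close> avoids any right continuity of the grains in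
  time.

  The time density and the mark densities make the intensity absolutely continuous on space-time:
  it is the mixture of the mark distributions over the marginal intensity, so on a Lebesgue null set
  Fubini's theorem shows that almost every time section is null for its mark distribution
  (\<open>absolutely_continuous_intensity\<close>).  No joint measurability of the mark densities is needed.
  For such an intensity the growth model makes \<open>F\<close> continuously differentiable, in particular
  Lipschitz on bounded intervals; moreover \<open>F 0 = 0\<close> because the marginal intensity has no atom at \<open>0\<close>.

  A finite measure on the line whose distribution function has increments at most \<open>K\<close> times the
  length of the interval is bounded by \<open>K\<close> times Lebesgue measure
  (\<open>emeasure_le_lborel_of_Lipschitz_cdf\<close>), so the law of the capture time is absolutely continuous,
  and the Radon-Nikodym theorem provides the density.\<close>

section \<open>Measures on the line with Lipschitz distribution function\<close>

text \<open>The difference between \<open>K\<close> times the identity and the distribution function of \<open>L\<close> is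
  nondecreasing and right continuous, so it defines a measure which, added to \<open>L\<close>, gives \<open>K\<close>
  times Lebesgue measure.\<close>

lemma emeasure_le_lborel_of_Lipschitz_cdf:
  fixes L :: "real measure"
  assumes L: "finite_borel_measure L" and K: "0 \<le> K"
    and le: "\<And>a b. a \<le> b \<Longrightarrow> measure L {a<..b} \<le> K * (b - a)"
    and A: "A \<in> sets borel"
  shows "emeasure L A \<le> ennreal K * emeasure lborel A"
proof -
  interpret L: finite_borel_measure L by fact
  define g where "g b = K * b - cdf L b" for b
  have g_mono: "g a \<le> g b" if "a \<le> b" for a b
    using le[of a b] L.cdf_diff_eq[of a b] that
    by (cases "a = b") (auto simp: g_def algebra_simps)
  have g_cont: "continuous (at_right a) g" for a
    unfolding g_def by (intro continuous_intros L.cdf_is_right_cont)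
  define \<nu> where "\<nu> = measure_of UNIV (sets borel)
    (\<lambda>B. emeasure L B + emeasure (interval_measure g) B)"
  have sets_\<nu>: "sets \<nu> = sets borel"
    using sets.sigma_sets_eq[of "borel :: real measure"] by (simp add: \<nu>_def)
  have \<nu>: "emeasure \<nu> B = emeasure L B + emeasure (interval_measure g) B"
    if "B \<in> sets borel" for B
  proof (rule emeasure_measure_of[OF \<nu>_def])
    show "countably_additive (sets \<nu>) (\<lambda>B. emeasure L B + emeasure (interval_measure g) B)"
      unfolding countably_additive_def
    proof safe
      fix F :: "nat \<Rightarrow> real set" assume F: "range F \<subseteq> sets \<nu>" "disjoint_family F"
      have "(\<Sum>i. emeasure L (F i) + emeasure (interval_measure g) (F i)) =
          (\<Sum>i. emeasure L (F i)) + (\<Sum>i. emeasure (interval_measure g) (F i))"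
        by (rule suminf_add[symmetric]) auto
      also have "\<dots> = emeasure L (\<Union>i. F i) + emeasure (interval_measure g) (\<Union>i. F i)"
        using F by (subst (1 2) suminf_emeasure) (auto simp: sets_\<nu> L.M_is_borel)
      finally show "(\<Sum>i. emeasure L (F i) + emeasure (interval_measure g) (F i)) =
        emeasure L (\<Union>i. F i) + emeasure (interval_measure g) (\<Union>i. F i)" .
    qed
  qed (use that sets_\<nu> in \<open>auto simp: positive_def\<close>)
  have "\<nu> = density lborel (\<lambda>_. ennreal K)"
  proof (rule measure_eqI_generator_eq)
    let ?E = "range (\<lambda>(a, b). {a<..b::real})"
    show "Int_stable ?E"
      by (auto simp: Int_stable_def)
    show "?E \<subseteq> Pow UNIV" by simp
    show "sets \<nu> = sigma_sets UNIV ?E" "sets (density lborel (\<lambda>_. ennreal K)) = sigma_sets UNIV ?E"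
      by (simp_all add: sets_\<nu> borel_sigma_sets_Ioc)
    show eq: "emeasure \<nu> E = emeasure (density lborel (\<lambda>_. ennreal K)) E" if "E \<in> ?E" for E
    proof -
      from that obtain a b where E: "E = {a<..b}" by auto
      show ?thesis
      proof (cases "a < b")
        case True
        have "emeasure \<nu> E = ennreal (cdf L b - cdf L a) + ennreal (g b - g a)"
          using True L.cdf_diff_eq[of a b] unfolding E
          by (subst \<nu>) (auto simp: emeasure_interval_measure_Ioc g_mono g_cont L.emeasure_eq_measure)
        also have "\<dots> = ennreal (K * (b - a))"
          using True L.cdf_diff_eq[of a b] g_mono[of a b]
          by (subst ennreal_plus[symmetric]) (auto simp: g_def algebra_simps)
        finally show ?thesis
          using True K by (simp add: E emeasure_density_const ennreal_mult)
      qed (simp add: E)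
    qed
    show "range (\<lambda>i::nat. {- real i<..real i}) \<subseteq> ?E" by auto
    show "(\<Union>i::nat. {- real i<..real i}) = UNIV"
      by (rule UN_Ioc_eq_UNIV)
    show "emeasure \<nu> {- real i<..real i} \<noteq> \<infinity>" for i :: nat
      by (subst eq) (auto simp: emeasure_density_const ennreal_mult_eq_top_iff)
  qed
  then have "emeasure L A + emeasure (interval_measure g) A = ennreal K * emeasure lborel A"
    using \<nu>[OF A] A by (simp add: emeasure_density_const)
  then show ?thesis by (metis le_iff_add)
qed

lemma absolutely_continuous_of_locally_Lipschitz_cdf:
  fixes L :: "real measure"
  assumes L: "finite_borel_measure L" and neg: "emeasure L {..0} = 0"
    and le: "\<And>n::nat. \<exists>K\<ge>0. \<forall>a b. 0 \<le> a \<longrightarrow> a \<le> b \<longrightarrow> b \<le> real n \<longrightarrow> measure L {a<..b} \<le> K * (b - a)"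
  shows "absolutely_continuous lborel L"
proof -
  interpret L: finite_borel_measure L by fact
  note [measurable_cong] = L.M_is_borel
  have null: "emeasure L (A \<inter> {0<..real n}) = 0"
    if A: "A \<in> sets borel" "emeasure lborel A = 0" for A n
  proof -
    obtain K where K: "K \<ge> 0"
      "\<And>a b. 0 \<le> a \<Longrightarrow> a \<le> b \<Longrightarrow> b \<le> real n \<Longrightarrow> measure L {a<..b} \<le> K * (b - a)"
      using le[of n] by blast
    \<comment> \<open>The restriction of \<open>L\<close> to \<open>(0, n]\<close> satisfies the Lipschitz bound on the whole line.\<close>
    define L' where "L' = density L (indicator {0<..real n})"
    have L': "emeasure L' B = emeasure L (B \<inter> {0<..real n})" if "B \<in> sets borel" for B
      using that by (simp add: L'_def emeasure_restricted Int_commute L.M_is_borel)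
    have sets_L': "sets L' = sets borel" "space L' = UNIV"
      by (simp_all add: L'_def L.M_is_borel L.borel_UNIV)
    have "emeasure L' (space L') \<noteq> \<infinity>"
      unfolding sets_L'(2) by (subst L') (simp_all add: L.emeasure_eq_measure)
    then have "finite_borel_measure L'"
      using sets_L'(1)
      by (intro finite_borel_measure.intro finite_borel_measure_axioms.intro finite_measureI)
    moreover have "measure L' {a<..b} \<le> K * (b - a)" if "a \<le> b" for a b
    proof -
      have "measure L' {a<..b} = measure L {max a 0<..min b (real n)}"
        unfolding measure_def by (subst L') simp_all
      also have "\<dots> \<le> K * (b - a)"
      proof (cases "max a 0 \<le> min b (real n)")
        case True
        have "measure L {max a 0<..min b (real n)} \<le> K * (min b (real n) - max a 0)"
          using True by (intro K) auto
        also have "\<dots> \<le> K * (b - a)"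
          using K(1) by (intro mult_left_mono) auto
        finally show ?thesis .
      next
        case False
        then have empty: "{max a 0<..min b (real n)} = {}" by (simp only: greaterThanAtMost_empty_iff)
        show ?thesis unfolding empty using mult_nonneg_nonneg[of K "b - a"] K(1) that by simp
      qed
      finally show ?thesis .
    qed
    ultimately have "emeasure L' A \<le> ennreal K * emeasure lborel A"
      using K(1) A(1) by (intro emeasure_le_lborel_of_Lipschitz_cdf)
    then show ?thesis using A L'[of A] by simp
  qed
  show ?thesis
    unfolding absolutely_continuous_def
  proof
    fix A assume "A \<in> null_sets (lborel :: real measure)"
    then have A: "A \<in> sets borel" "emeasure lborel A = 0" by auto
    have "emeasure L (A \<inter> {..0}) \<le> emeasure L {..0}"
      by (rule emeasure_mono) (simp_all add: L.M_is_borel)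
    then have "A \<inter> {..0} \<in> null_sets L"
      using A(1) neg by (simp add: null_sets_def L.M_is_borel)
    moreover have "A \<inter> {0<..real n} \<in> null_sets L" for n
      using null[OF A] A(1) by (simp add: null_sets_def L.M_is_borel)
    ultimately have "(A \<inter> {..0}) \<union> (\<Union>n. A \<inter> {0<..real n}) \<in> null_sets L"
      by (intro null_sets.Un null_sets_UN)
    also have "(A \<inter> {..0}) \<union> (\<Union>n. A \<inter> {0<..real n}) = A"
      using real_arch_simple by force
    finally show "A \<in> null_sets L" .
  qed
qed

lemma continuously_differentiable_on_Rplus_imp_Lipschitz:
  assumes "continuously_differentiable_on_Rplus f"
  obtains K where "0 \<le> K" "\<And>a b. 0 \<le> a \<Longrightarrow> a \<le> b \<Longrightarrow> b \<le> c \<Longrightarrow> f b - f a \<le> K * (b - a)"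
proof -
  obtain f' where f': "continuous_on {0..} f'"
    "\<And>t. 0 \<le> t \<Longrightarrow> (f has_real_derivative f' t) (at t within {0..})"
    using assms unfolding continuously_differentiable_on_Rplus_def by blast
  have "compact (f' ` {0..c})"
    using f'(1) by (intro compact_continuous_image continuous_on_subset[OF f'(1)]) auto
  then obtain K where K: "0 < K" "\<And>t. t \<in> {0..c} \<Longrightarrow> norm (f' t) \<le> K"
    using compact_imp_bounded bounded_pos by (metis imageI)
  have "f b - f a \<le> K * (b - a)" if "0 \<le> a" "a \<le> b" "b \<le> c" for a b
  proof -
    have "(f has_field_derivative f' t) (at t within {0..c})" if "t \<in> {0..c}" for t
      using that by (intro has_field_derivative_subset[OF f'(2)]) auto
    then have "norm (f b - f a) \<le> K * norm (b - a)"
      using that K(2) by (intro field_differentiable_bound[of "{0..c}"]) auto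
    then show ?thesis using that by simp
  qed
  then show ?thesis using K(1) by (intro that[of K]) auto
qed

lemma ex_real_density:
  fixes N :: "real measure"
  assumes "finite_borel_measure N" "absolutely_continuous lborel N"
  shows "\<exists>f \<in> borel_measurable borel. (\<forall>t. 0 \<le> f t) \<and> N = density lborel (\<lambda>t. ennreal (f t))"
proof -
  interpret N: finite_borel_measure N by fact
  have sets: "sets N = sets lborel" by (simp add: N.M_is_borel)
  obtain f where f: "f \<in> borel_measurable lborel"
    "AE t in lborel. RN_deriv lborel N t = ennreal (f t)" "\<And>t. 0 \<le> f t"
    using sigma_finite_measure.real_RN_deriv[OF sigma_finite_lborel N.finite_measure_axioms assms(2) sets] by blast
  have "N = density lborel (RN_deriv lborel N)"
    using sigma_finite_measure.density_RN_deriv[OF sigma_finite_lborel assms(2) sets] by simp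
  also have "\<dots> = density lborel (\<lambda>t. ennreal (f t))"
    using f(1,2) by (intro density_cong) auto
  finally show ?thesis using f by (intro bexI[of _ f]) auto
qed

section \<open>The intensity measure\<close>

context nucleation_process
begin

lemma N_count_measurable:
  assumes "C \<in> sets borel"
  shows "(\<lambda>\<omega>. N_count T X \<omega> C) \<in> borel_measurable M"
  unfolding N_count_def
proof (rule borel_measurable_suminf_order)
  fix j
  have "(\<lambda>\<omega>. (real_of_ereal (T j \<omega>), X j \<omega>)) \<in> M \<rightarrow>\<^sub>M borel \<Otimes>\<^sub>M borel"
    using T_measurable X_measurable by (intro measurable_Pair borel_measurable_real_of_ereal) auto
  then have "(\<lambda>\<omega>. (real_of_ereal (T j \<omega>), X j \<omega>)) \<in> borel_measurable M"
    by (simp only: borel_prod)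
  then have "(\<lambda>\<omega>. indicator C (real_of_ereal (T j \<omega>), X j \<omega>) :: ennreal) \<in> borel_measurable M"
    by (rule measurable_compose) (rule borel_measurable_indicator[OF assms])
  moreover have "{\<omega> \<in> space M. T j \<omega> < \<infinity>} \<in> sets M"
    using T_measurable[of j] by measurable
  ultimately show "(\<lambda>\<omega>. if T j \<omega> < \<infinity> then indicator C (real_of_ereal (T j \<omega>), X j \<omega>) else (0::ennreal))
      \<in> borel_measurable M"
    by (intro measurable_If) auto
qed

lemma N_count_empty [simp]: "N_count T X \<omega> {} = 0"
  by (simp add: N_count_def cong: if_cong)

lemma N_count_suminf:
  assumes "disjoint_family F"
  shows "(\<Sum>i. N_count T X \<omega> (F i)) = N_count T X \<omega> (\<Union>i. F i)"
proof -
  let ?f = "\<lambda>C j. if T j \<omega> < \<infinity> then indicator C (real_of_ereal (T j \<omega>), X j \<omega>) else (0::ennreal)"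
  have "(\<Sum>i. N_count T X \<omega> (F i)) = (\<Sum>i. \<integral>\<^sup>+j. ?f (F i) j \<partial>count_space UNIV)"
    by (simp add: N_count_def nn_integral_count_space_nat)
  also have "\<dots> = (\<integral>\<^sup>+j. (\<Sum>i. ?f (F i) j) \<partial>count_space UNIV)"
    by (rule nn_integral_suminf[symmetric]) simp
  also have "\<dots> = (\<integral>\<^sup>+j. ?f (\<Union>i. F i) j \<partial>count_space UNIV)"
    using assms by (intro nn_integral_cong) (auto simp: suminf_indicator)
  finally show ?thesis by (simp add: N_count_def nn_integral_count_space_nat)
qed

lemma sets_intensity [simp, measurable_cong]: "sets (intensity M T X) = sets borel"
  using sets.sigma_sets_eq[of "borel :: (real \<times> (real^'n)) measure"] by (simp add: intensity_def)

lemma sets_marginal_intensity [simp, measurable_cong]: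
  "sets (marginal_intensity M T X) = sets borel"
  using sets.sigma_sets_eq[of "borel :: real measure"] by (simp add: marginal_intensity_def)

lemma emeasure_intensity:
  assumes "C \<in> sets borel"
  shows "emeasure (intensity M T X) C = (\<integral>\<^sup>+\<omega>. N_count T X \<omega> C \<partial>M)"
proof (rule emeasure_measure_of[OF intensity_def])
  show "countably_additive (sets (intensity M T X)) (\<lambda>C. \<integral>\<^sup>+\<omega>. N_count T X \<omega> C \<partial>M)"
    unfolding countably_additive_def
  proof safe
    fix F :: "nat \<Rightarrow> (real \<times> (real^'n)) set"
    assume F: "range F \<subseteq> sets (intensity M T X)" "disjoint_family F"
    then have "(\<Sum>i. \<integral>\<^sup>+\<omega>. N_count T X \<omega> (F i) \<partial>M) = (\<integral>\<^sup>+\<omega>. (\<Sum>i. N_count T X \<omega> (F i)) \<partial>M)"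
      by (intro nn_integral_suminf[symmetric] N_count_measurable) auto
    then show "(\<Sum>i. \<integral>\<^sup>+\<omega>. N_count T X \<omega> (F i) \<partial>M) = (\<integral>\<^sup>+\<omega>. N_count T X \<omega> (\<Union>i. F i) \<partial>M)"
      by (simp only: N_count_suminf[OF F(2)])
  qed
qed (use assms in \<open>auto simp: positive_def\<close>)

lemma emeasure_marginal_intensity:
  assumes "B \<in> sets borel"
  shows "emeasure (marginal_intensity M T X) B = emeasure (intensity M T X) (B \<times> UNIV)"
proof -
  have B: "B' \<times> (UNIV :: (real^'n) set) \<in> sets borel" if "B' \<in> sets borel" for B' :: "real set"
    using that by (intro borel_Times) auto
  have "emeasure (marginal_intensity M T X) B = (\<integral>\<^sup>+\<omega>. N_marginal T X \<omega> B \<partial>M)"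
  proof (rule emeasure_measure_of[OF marginal_intensity_def])
    show "countably_additive (sets (marginal_intensity M T X)) (\<lambda>B. \<integral>\<^sup>+\<omega>. N_marginal T X \<omega> B \<partial>M)"
      unfolding countably_additive_def
    proof safe
      fix F :: "nat \<Rightarrow> real set"
      assume F: "range F \<subseteq> sets (marginal_intensity M T X)" "disjoint_family F"
      then have disj: "disjoint_family (\<lambda>i. F i \<times> (UNIV :: (real^'n) set))"
        by (auto simp: disjoint_family_on_def)
      have UN_Times: "(\<Union>i. F i) \<times> (UNIV :: (real^'n) set) = (\<Union>i. F i \<times> UNIV)"
        by auto
      note sums = N_count_suminf[OF disj]
      have "(\<Sum>i. \<integral>\<^sup>+\<omega>. N_marginal T X \<omega> (F i) \<partial>M) = (\<integral>\<^sup>+\<omega>. (\<Sum>i. N_marginal T X \<omega> (F i)) \<partial>M)"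
        using F unfolding N_marginal_def
        by (intro nn_integral_suminf[symmetric] N_count_measurable B) auto
      then show "(\<Sum>i. \<integral>\<^sup>+\<omega>. N_marginal T X \<omega> (F i) \<partial>M) = (\<integral>\<^sup>+\<omega>. N_marginal T X \<omega> (\<Union>i. F i) \<partial>M)"
        unfolding N_marginal_def sums UN_Times .
    qed
  qed (use assms in \<open>auto simp: positive_def N_marginal_def\<close>)
  then show ?thesis
    using assms by (simp add: emeasure_intensity B N_marginal_def)
qed

end

lemma (in nucleation_process) N_count_nonneg_times:
  assumes "\<omega> \<in> space M"
  shows "N_count T X \<omega> (C \<inter> {0..} \<times> UNIV) = N_count T X \<omega> C"
proof -
  have "0 \<le> real_of_ereal (T j \<omega>)" for j
    using T_nonneg[OF assms] by (simp add: real_of_ereal_pos)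
  then show ?thesis
    unfolding N_count_def by (intro suminf_cong) (auto simp: indicator_def)
qed

context nucleation_process_with_marks
begin

text \<open>The decomposition of the intensity, given on rectangles, extends to all Borel sets: both sides are
  measures, the right-hand side being the monadic bind of the marginal intensity on \<open>[0, \<infinity>)\<close> with
  the kernel that puts the mark distribution \<open>Q t\<close> on the slice over \<open>t\<close>, and they are finite on
  bounded time slabs.\<close>

lemma emeasure_intensity_eq_nn_integral_sections:
  assumes finite: "\<And>K. compact K \<Longrightarrow> emeasure (marginal_intensity M T X) K < \<infinity>"
    and C: "C \<in> sets borel"
  shows "emeasure (intensity M T X) C =
    (\<integral>\<^sup>+t\<in>{0..}. emeasure (Q t) (Pair t -` C) \<partial>marginal_intensity M T X)"
proof -
  let ?\<Lambda> = "intensity M T X" and ?\<mu> = "marginal_intensity M T X"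
  define R where "R = restrict_space ?\<mu> {0..}"
  have sets_R: "sets R = sets (restrict_space borel {0..})"
    unfolding R_def by (rule sets_restrict_space_cong) simp
  have space_R: "space R = {0..}"
    using sets_eq_imp_space_eq[OF sets_R] by (simp add: space_restrict_space)
  have Q: "Q \<in> R \<rightarrow>\<^sub>M subprob_algebra borel"
    using measurable_prob_algebraD[OF Q_kernel] by (simp add: measurable_cong_sets[OF sets_R refl])
  have sets_Q: "sets (Q t) = sets borel" if "0 \<le> t" for t
    using that by (intro sets_kernel[OF Q]) (simp add: space_R)
  have id: "(\<lambda>t. t) \<in> R \<rightarrow>\<^sub>M borel"
    unfolding measurable_cong_sets[OF sets_R refl] by (rule measurable_restrict_space1) simp
  have "(\<lambda>p. p) \<in> R \<Otimes>\<^sub>M borel \<rightarrow>\<^sub>M borel \<Otimes>\<^sub>M (borel :: (real^'n) measure)"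
    using measurable_Pair[OF measurable_compose[OF measurable_fst id] measurable_snd] by simp
  then have "(\<lambda>(t, y). (t, y)) \<in> R \<Otimes>\<^sub>M borel \<rightarrow>\<^sub>M (borel :: (real \<times> (real^'n)) measure)"
    by (simp add: borel_prod)
  then have kernel: "(\<lambda>t. distr (Q t) borel (Pair t)) \<in> R \<rightarrow>\<^sub>M subprob_algebra borel"
    by (intro measurable_distr2[where M=borel] Q)
  define \<nu> where "\<nu> = R \<bind> (\<lambda>t. distr (Q t) borel (Pair t))"
  have sets_\<nu>: "sets \<nu> = sets borel"
    unfolding \<nu>_def by (rule sets_bind_measurable[OF kernel]) (simp add: space_R)
  have \<nu>: "emeasure \<nu> D = (\<integral>\<^sup>+t\<in>{0..}. emeasure (Q t) (Pair t -` D) \<partial>?\<mu>)"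
    if D: "D \<in> sets borel" for D
  proof -
    have "emeasure \<nu> D = (\<integral>\<^sup>+t. emeasure (distr (Q t) borel (Pair t)) D \<partial>R)"
      unfolding \<nu>_def by (rule emeasure_bind[OF _ kernel D]) (simp add: space_R)
    also have "\<dots> = (\<integral>\<^sup>+t. emeasure (Q t) (Pair t -` D) \<partial>R)"
    proof (rule nn_integral_cong)
      fix t assume "t \<in> space R"
      then have t: "sets (Q t) = sets borel" by (simp add: sets_Q space_R)
      then have "Pair t \<in> Q t \<rightarrow>\<^sub>M borel"
        by (subst measurable_cong_sets[OF t refl]) (simp add: borel_measurable_continuous_onI continuous_on_Pair)
      then show "emeasure (distr (Q t) borel (Pair t)) D = emeasure (Q t) (Pair t -` D)"
        using D sets_eq_imp_space_eq[OF t] by (simp add: emeasure_distr)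
    qed
    also have "\<dots> = (\<integral>\<^sup>+t\<in>{0..}. emeasure (Q t) (Pair t -` D) \<partial>?\<mu>)"
      unfolding R_def by (rule nn_integral_restrict_space) simp
    finally show ?thesis .
  qed
  have "?\<Lambda> = \<nu>"
  proof (rule measure_eqI_generator_eq[OF Int_stable_pair_measure_generator[of borel borel]])
    let ?E = "{a \<times> b | a b. a \<in> sets (borel :: real measure) \<and> b \<in> sets (borel :: (real^'n) measure)}"
    have "sets (borel \<Otimes>\<^sub>M borel) = sigma_sets UNIV ?E"
      by (simp add: sets_pair_measure)
    then have E: "sets borel = sigma_sets UNIV ?E"
      by (simp only: borel_prod)
    show "sets ?\<Lambda> = sigma_sets UNIV ?E" "sets \<nu> = sigma_sets UNIV ?E"
      using E by (simp_all only: sets_intensity sets_\<nu>)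
    show "?E \<subseteq> Pow UNIV" by simp
    show "emeasure ?\<Lambda> D = emeasure \<nu> D" if "D \<in> ?E" for D
    proof -
      from that obtain B A where D: "D = B \<times> A" and BA: "B \<in> sets borel" "A \<in> sets borel"
        by auto
      then have D_borel: "D \<in> sets borel" by (auto intro: borel_Times)
      \<comment> \<open>The decomposition is known over times in \<open>[0, \<infinity>)\<close> only, but no birth time is negative.\<close>
      have D': "D \<inter> {0..} \<times> UNIV = (B \<inter> {0..}) \<times> A" using D by auto
      have "emeasure ?\<Lambda> D = (\<integral>\<^sup>+\<omega>. N_count T X \<omega> (D \<inter> {0..} \<times> UNIV) \<partial>M)"
        using D_borel by (simp add: emeasure_intensity N_count_nonneg_times cong: nn_integral_cong)
      also have "\<dots> = emeasure ?\<Lambda> ((B \<inter> {0..}) \<times> A)"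
        unfolding D' using BA by (intro emeasure_intensity[symmetric] borel_Times) auto
      also have "\<dots> = (\<integral>\<^sup>+t\<in>B \<inter> {0..}. emeasure (Q t) A \<partial>?\<mu>)"
        using BA by (intro intensity_decomposition) auto
      also have "\<dots> = (\<integral>\<^sup>+t\<in>{0..}. emeasure (Q t) (Pair t -` D) \<partial>?\<mu>)"
        unfolding D by (intro nn_integral_cong) (auto simp: indicator_def vimage_def)
      finally show ?thesis by (simp add: \<nu>[OF D_borel])
    qed
    have "{- real i..real i} \<times> UNIV \<in> ?E" for i :: nat
      by (rule CollectI, intro exI conjI) auto
    then show "range (\<lambda>i::nat. {- real i..real i} \<times> UNIV) \<subseteq> ?E" by blast
    show "(\<Union>i::nat. {- real i..real i} \<times> (UNIV :: (real^'n) set)) = UNIV"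
    proof safe
      fix t :: real and y :: "real^'n"
      obtain n :: nat where "\<bar>t\<bar> < real n" using reals_Archimedean2 by blast
      then show "(t, y) \<in> (\<Union>i::nat. {- real i..real i} \<times> UNIV)" by (auto intro!: exI[of _ n])
    qed simp
    show "emeasure ?\<Lambda> ({- real i..real i} \<times> UNIV) \<noteq> \<infinity>" for i :: nat
      using finite[of "{- real i..real i}"] by (simp add: emeasure_marginal_intensity)
  qed
  then show ?thesis using \<nu>[OF C] by simp
qed

lemma absolutely_continuous_intensity:
  assumes finite: "\<And>K. compact K \<Longrightarrow> emeasure (marginal_intensity M T X) K < \<infinity>"
    and time: "absolutely_continuous lborel (marginal_intensity M T X)"
    and mark: "\<And>t. 0 < t \<Longrightarrow> absolutely_continuous lborel (Q t)"
  shows "absolutely_continuous (lborel \<Otimes>\<^sub>M lborel) (intensity M T X)"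
  unfolding absolutely_continuous_def
proof
  fix C assume "C \<in> null_sets (lborel \<Otimes>\<^sub>M (lborel :: (real^'n) measure) :: (real \<times> (real^'n)) measure)"
  then have C: "C \<in> sets (borel \<Otimes>\<^sub>M borel)" "AE p in lborel \<Otimes>\<^sub>M lborel. p \<notin> C"
    by (auto simp: AE_not_in null_sets_def cong: sets_pair_measure_cong)
  have C_borel: "C \<in> sets borel" using C(1) unfolding borel_prod .
  \<comment> \<open>Time \<open>0\<close>, where the mark distribution need not have a density, is a null set.\<close>
  have "AE t in lborel. t \<noteq> 0 \<and> (AE y in lborel. (t, y) \<notin> C)"
    using AE_lborel_singleton lborel_pair.AE_pair[OF C(2)] by (rule AE_conjI)
  moreover have "emeasure (Q t) (Pair t -` C) * indicator {0..} t = 0"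
    if "t \<noteq> 0 \<and> (AE y in lborel. (t, y) \<notin> C)" for t
  proof (cases "0 < t")
    case True
    have "Pair t -` C \<in> sets borel"
      using sets_Pair1[OF C(1)] by simp
    then have "Pair t -` C \<in> null_sets lborel"
      using that by (subst AE_iff_null_sets) (auto simp: vimage_def)
    then show ?thesis
      using mark[OF True] by (auto simp: absolutely_continuous_def null_sets_def)
  qed (use that in auto)
  ultimately have "AE t in lborel. emeasure (Q t) (Pair t -` C) * indicator {0..} t = 0"
    by (auto elim: eventually_mono)
  then have "AE t in marginal_intensity M T X. emeasure (Q t) (Pair t -` C) * indicator {0..} t = 0"
    by (intro absolutely_continuous_AE[OF _ time]) simp_all
  then have "(\<integral>\<^sup>+t\<in>{0..}. emeasure (Q t) (Pair t -` C) \<partial>marginal_intensity M T X) =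
      (\<integral>\<^sup>+t. 0 \<partial>marginal_intensity M T X)"
    by (rule nn_integral_cong_AE)
  moreover have "emeasure (intensity M T X) C =
      (\<integral>\<^sup>+t\<in>{0..}. emeasure (Q t) (Pair t -` C) \<partial>marginal_intensity M T X)"
    by (rule emeasure_intensity_eq_nn_integral_sections[OF finite C_borel])
  ultimately show "C \<in> null_sets (intensity M T X)"
    using C_borel by (simp add: null_sets_def)
qed

end

section \<open>Capture of a point\<close>

context birth_and_growth
begin

lemma crystal_mono:
  assumes \<omega>: "\<omega> \<in> space M" and "t \<le> u"
  shows "crystal T X Gr t \<omega> \<subseteq> crystal T X Gr u \<omega>"
proof
  fix x assume "x \<in> crystal T X Gr t \<omega>"
  then obtain j where j: "T j \<omega> \<le> ereal t" "x \<in> Gr (real_of_ereal (T j \<omega>)) t (X j \<omega>)"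
    by (auto simp: crystal_def)
  have "0 \<le> real_of_ereal (T j \<omega>)" "real_of_ereal (T j \<omega>) \<le> t"
    using T_nonneg[OF \<omega>, of j] j(1) by (cases "T j \<omega>"; simp)+
  then have "x \<in> Gr (real_of_ereal (T j \<omega>)) u (X j \<omega>)"
    using grain_mono[of "real_of_ereal (T j \<omega>)" t u "X j \<omega>"] j(2) \<open>t \<le> u\<close> by auto
  moreover have "T j \<omega> \<le> ereal u"
    using j(1) \<open>t \<le> u\<close> by (meson ereal_less_eq(3) order_trans)
  ultimately show "x \<in> crystal T X Gr u \<omega>" by (auto simp: crystal_def)
qed

lemma crystal_neg:
  assumes "\<omega> \<in> space M" "t < 0"
  shows "crystal T X Gr t \<omega> = {}"
proof -
  have "\<not> T j \<omega> \<le> ereal t" for j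
    using T_nonneg[OF assms(1), of j] assms(2) by (cases "T j \<omega>") auto
  then show ?thesis by (simp add: crystal_def)
qed

lemma causal_cone_neg: "t < 0 \<Longrightarrow> causal_cone Gr t x = {}"
  by (auto simp: causal_cone_def)

lemma crystal_hit_measurable: "{\<omega> \<in> space M. x \<in> crystal T X Gr t \<omega>} \<in> sets M"
proof (cases "0 \<le> t")
  case True
  have "\<forall>K. compact K \<longrightarrow> {\<omega> \<in> space M. crystal T X Gr t \<omega> \<inter> K \<noteq> {}} \<in> sets M"
    using crystal_random[OF True] unfolding random_closed_set_def by (rule conjunct2)
  then have "{\<omega> \<in> space M. crystal T X Gr t \<omega> \<inter> {x} \<noteq> {}} \<in> sets M"
    by (rule allE) (erule mp, rule compact_sing)
  also have "{\<omega> \<in> space M. crystal T X Gr t \<omega> \<inter> {x} \<noteq> {}} = {\<omega> \<in> space M. x \<in> crystal T X Gr t \<omega>}"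
    by auto
  finally show ?thesis .
next
  case False
  then have "{\<omega> \<in> space M. x \<in> crystal T X Gr t \<omega>} = {}"
    by (simp add: crystal_neg cong: conj_cong)
  then show ?thesis by (simp only: sets.empty_sets)
qed

lemma causal_cone_borel: "causal_cone Gr t x \<in> sets borel"
  using cone_measurable[of t x] by (cases "0 \<le> t") (simp_all add: causal_cone_neg)

lemma causal_cone_mono:
  assumes "a \<le> u"
  shows "causal_cone Gr a x \<subseteq> causal_cone Gr u x"
  using grain_mono[of _ a u] assms by (fastforce simp: causal_cone_def)

text \<open>Negative values of \<open>a\<close> and \<open>u\<close> are admitted: crystal and cone are then empty.  With \<open>a < 0\<close> this
  bounds the probability that \<open>x\<close> is covered at time \<open>u\<close>.\<close>

lemma emeasure_newly_covered_le:
  "emeasure M {\<omega> \<in> space M. x \<in> crystal T X Gr u \<omega> \<and> x \<notin> crystal T X Gr a \<omega>} \<le>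
    emeasure (intensity M T X) (causal_cone Gr u x - causal_cone Gr a x)"
    (is "emeasure M ?E \<le> emeasure _ ?C")
proof -
  have C: "?C \<in> sets borel" by (intro sets.Diff causal_cone_borel)
  have "?E = {\<omega> \<in> space M. x \<in> crystal T X Gr u \<omega>} - {\<omega> \<in> space M. x \<in> crystal T X Gr a \<omega>}"
    by auto
  then have E: "?E \<in> sets M" by (simp only: sets.Diff crystal_hit_measurable)
  have "indicator ?E \<omega> \<le> N_count T X \<omega> ?C" if \<omega>: "\<omega> \<in> space M" for \<omega>
  proof (cases "\<omega> \<in> ?E")
    case True
    then obtain j where j: "T j \<omega> \<le> ereal u" "x \<in> Gr (real_of_ereal (T j \<omega>)) u (X j \<omega>)"
      by (auto simp: crystal_def)
    obtain s where s: "T j \<omega> = ereal s" "0 \<le> s" "s \<le> u"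
      using T_nonneg[OF \<omega>, of j] j(1) by (cases "T j \<omega>") auto
    have "x \<notin> Gr s a (X j \<omega>)" if "s \<le> a"
    proof
      assume "x \<in> Gr s a (X j \<omega>)"
      then have "x \<in> crystal T X Gr a \<omega>"
        unfolding crystal_def using that s(1) by (intro UN_I[of j]) auto
      then show False using True by blast
    qed
    then have "(s, X j \<omega>) \<in> ?C"
      using s j(2) by (auto simp: causal_cone_def)
    let ?f = "\<lambda>i. if T i \<omega> < \<infinity> then indicator ?C (real_of_ereal (T i \<omega>), X i \<omega>) else (0::ennreal)"
    have "1 = ?f j" using \<open>(s, X j \<omega>) \<in> ?C\<close> by (simp add: s(1))
    also have "\<dots> \<le> (\<Sum>i. ?f i)"
      using sum_le_suminf[of ?f "{j}"] by simp
    finally show ?thesis using True by (simp add: N_count_def)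
  qed simp
  then have "(\<integral>\<^sup>+\<omega>. indicator ?E \<omega> \<partial>M) \<le> (\<integral>\<^sup>+\<omega>. N_count T X \<omega> ?C \<partial>M)"
    by (rule nn_integral_mono)
  then show ?thesis using E C by (simp add: emeasure_intensity)
qed

text \<open>Since the crystal grows with time, rational times suffice, which makes the capture time
  measurable.\<close>

lemma capture_time_less_iff:
  assumes "\<omega> \<in> space M"
  shows "capture_time T X Gr x \<omega> < c \<longleftrightarrow>
    (\<exists>q\<in>\<rat>. 0 < q \<and> ereal q < c \<and> x \<in> crystal T X Gr q \<omega>)"
proof
  assume "capture_time T X Gr x \<omega> < c"
  then obtain t where t: "0 < t" "x \<in> crystal T X Gr t \<omega>" "ereal t < c"
    by (auto simp: capture_time_def Inf_less_iff)
  obtain r where r: "ereal t < r" "r < c" using dense t(3) by blast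
  then obtain u where "t < u" "ereal u < c" by (cases r) auto
  then obtain q where q: "q \<in> \<rat>" "t < q" "q < u" using Rats_dense_in_real by blast
  have "ereal q < c" using q(3) \<open>ereal u < c\<close> by (meson less_ereal.simps(1) less_trans)
  then show "\<exists>q\<in>\<rat>. 0 < q \<and> ereal q < c \<and> x \<in> crystal T X Gr q \<omega>"
    using q t crystal_mono[OF assms, of t q] by (intro bexI[of _ q]) auto
qed (auto simp: capture_time_def Inf_less_iff)

lemma capture_time_measurable: "capture_time T X Gr x \<in> borel_measurable M"
proof (rule borel_measurableI_less)
  fix c :: ereal
  have "{\<omega> \<in> space M. capture_time T X Gr x \<omega> < c} =
    (\<Union>q\<in>{q\<in>\<rat>. 0 < q \<and> ereal q < c}. {\<omega> \<in> space M. x \<in> crystal T X Gr q \<omega>})"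
    using capture_time_less_iff by auto
  also have "\<dots> \<in> sets M"
    by (intro sets.countable_UN')
      (auto intro: countable_subset[OF _ countable_rat] simp: crystal_hit_measurable)
  finally show "{\<omega> \<in> space M. capture_time T X Gr x \<omega> < c} \<in> sets M" .
qed

lemma capture_time_nonneg: "0 \<le> capture_time T X Gr x \<omega>"
  unfolding capture_time_def by (auto intro!: Inf_greatest)

text \<open>The infimum in the capture time need not be attained, hence the strict inequality.\<close>

lemma crystal_if_capture_time_less:
  assumes "\<omega> \<in> space M" "capture_time T X Gr x \<omega> < ereal u"
  shows "x \<in> crystal T X Gr u \<omega>"
proof -
  obtain q where "q < u" "x \<in> crystal T X Gr q \<omega>"
    using assms by (auto simp: capture_time_less_iff)
  then show ?thesis using crystal_mono[OF assms(1), of q u] by auto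
qed

lemma capture_time_le_if_crystal:
  assumes \<omega>: "\<omega> \<in> space M" and a: "x \<in> crystal T X Gr a \<omega>"
  shows "capture_time T X Gr x \<omega> \<le> ereal a"
proof (rule dense_ge)
  have "0 \<le> a" using crystal_neg[OF \<omega>, of a] a by (cases "0 \<le> a") auto
  fix z assume z: "ereal a < z"
  have "ereal t \<ge> capture_time T X Gr x \<omega>" if "a < t" for t
    unfolding capture_time_def
    using that a crystal_mono[OF \<omega>, of a t] \<open>0 \<le> a\<close> by (intro Inf_lower) auto
  then show "capture_time T X Gr x \<omega> \<le> z" using z by (cases z) auto
qed

end

section \<open>The law of the capture time\<close>

lemma
  fixes Y :: "'w \<Rightarrow> ereal"
  assumes Y: "Y \<in> borel_measurable M"
  shows sets_real_law [simp]: "sets (real_law M Y) = sets borel"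
    and emeasure_real_law: "A \<in> sets borel \<Longrightarrow>
      emeasure (real_law M Y) A = emeasure M {\<omega> \<in> space M. Y \<omega> < \<infinity> \<and> real_of_ereal (Y \<omega>) \<in> A}"
proof -
  note Y [measurable]
  show "sets (real_law M Y) = sets borel" by (simp add: real_law_def)
  assume [measurable]: "A \<in> sets borel"
  let ?R = "restrict_space M {\<omega>. Y \<omega> < \<infinity>}"
  have S: "{\<omega>. Y \<omega> < \<infinity>} \<inter> space M \<in> sets M"
    by (subst Int_commute) (simp add: Collect_conj_eq[symmetric] Int_def)
  have "(\<lambda>\<omega>. real_of_ereal (Y \<omega>)) \<in> borel_measurable ?R"
    by (intro measurable_restrict_space1) measurable
  then have "emeasure (real_law M Y) A = emeasure ?R ((\<lambda>\<omega>. real_of_ereal (Y \<omega>)) -` A \<inter> space ?R)"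
    unfolding real_law_def by (intro emeasure_distr) auto
  also have "\<dots> = emeasure M ((\<lambda>\<omega>. real_of_ereal (Y \<omega>)) -` A \<inter> space ?R)"
    using S by (intro emeasure_restrict_space) (auto simp: space_restrict_space)
  also have "(\<lambda>\<omega>. real_of_ereal (Y \<omega>)) -` A \<inter> space ?R =
      {\<omega> \<in> space M. Y \<omega> < \<infinity> \<and> real_of_ereal (Y \<omega>) \<in> A}"
    by (auto simp: space_restrict_space)
  finally show "emeasure (real_law M Y) A =
    emeasure M {\<omega> \<in> space M. Y \<omega> < \<infinity> \<and> real_of_ereal (Y \<omega>) \<in> A}" .
qed

lemma (in prob_space) finite_borel_measure_real_law:
  assumes "Y \<in> borel_measurable M"
  shows "finite_borel_measure (real_law M Y)"
proof (intro finite_borel_measure.intro finite_borel_measure_axioms.intro finite_measureI)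
  show sets: "sets (real_law M Y) = sets borel" using assms by simp
  have "space (real_law M Y) = UNIV" using sets_eq_imp_space_eq[OF sets] by simp
  then show "emeasure (real_law M Y) (space (real_law M Y)) \<noteq> \<infinity>"
    using assms by (simp add: emeasure_real_law)
qed

context class_G
begin

lemma absolutely_continuous_marginal_intensity:
  "absolutely_continuous lborel (marginal_intensity M T X)"
proof -
  obtain l where "l \<in> borel_measurable borel"
    "marginal_intensity M T X = density lborel (\<lambda>t. ennreal (l t))"
    using A2_time_density by blast
  then show ?thesis
    by (simp add: absolutely_continuousI_density)
qed

lemma cone_intensity_C1:
  "continuously_differentiable_on_Rplus (\<lambda>t. measure (intensity M T X) (causal_cone Gr t x))"
proof (rule cone_C1[OF absolutely_continuous_intensity[OF A2_locally_finite
        absolutely_continuous_marginal_intensity]])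
  fix t :: real assume "0 < t"
  then obtain q where "q \<in> borel_measurable borel" "Q t = density lborel (\<lambda>y. ennreal (q y))"
    using A2_mark_density by blast
  then show "absolutely_continuous lborel (Q t)"
    by (simp add: absolutely_continuousI_density)
qed

lemma emeasure_cone_le:
  "emeasure (intensity M T X) (causal_cone Gr t x) \<le>
    emeasure (marginal_intensity M T X) {0..t}"
proof -
  have "emeasure (intensity M T X) (causal_cone Gr t x) \<le> emeasure (intensity M T X) ({0..t} \<times> UNIV)"
    by (rule emeasure_mono) (auto simp: causal_cone_def intro: borel_Times)
  then show ?thesis by (simp add: emeasure_marginal_intensity)
qed

text \<open>The left end \<open>a\<close> may be negative, in which case its cone is empty; this covers the
  event that \<open>x\<close> is captured at time \<open>0\<close>.\<close>

lemma measure_law_Ioc_le: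
  assumes "a \<le> b" "0 \<le> b"
  shows "measure (real_law M (capture_time T X Gr x)) {a<..b} \<le>
    measure (intensity M T X) (causal_cone Gr b x) - measure (intensity M T X) (causal_cone Gr a x)"
proof -
  let ?Y = "capture_time T X Gr x"
  define F where "F t = measure (intensity M T X) (causal_cone Gr t x)" for t
  interpret L: finite_borel_measure "real_law M ?Y"
    by (intro finite_borel_measure_real_law capture_time_measurable)
  have fin: "emeasure (intensity M T X) (causal_cone Gr t x) \<noteq> \<infinity>" for t
    using emeasure_cone_le[of t x] A2_locally_finite[of "{0..t}"] by (auto simp: top_unique)
  have le: "measure (real_law M ?Y) {a<..b} \<le> F u - F a" if "b < u" for u
  proof -
    have "emeasure (real_law M ?Y) {a<..b} =
        emeasure M {\<omega> \<in> space M. ?Y \<omega> < \<infinity> \<and> real_of_ereal (?Y \<omega>) \<in> {a<..b}}"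
      by (rule emeasure_real_law[OF capture_time_measurable]) simp
    also have "\<dots> \<le> emeasure M {\<omega> \<in> space M. x \<in> crystal T X Gr u \<omega> \<and> x \<notin> crystal T X Gr a \<omega>}"
    proof (rule emeasure_mono)
      have "{\<omega> \<in> space M. x \<in> crystal T X Gr u \<omega> \<and> x \<notin> crystal T X Gr a \<omega>} =
          {\<omega> \<in> space M. x \<in> crystal T X Gr u \<omega>} - {\<omega> \<in> space M. x \<in> crystal T X Gr a \<omega>}"
        by auto
      then show "{\<omega> \<in> space M. x \<in> crystal T X Gr u \<omega> \<and> x \<notin> crystal T X Gr a \<omega>} \<in> sets M"
        by (simp only: sets.Diff crystal_hit_measurable)
      show "{\<omega> \<in> space M. ?Y \<omega> < \<infinity> \<and> real_of_ereal (?Y \<omega>) \<in> {a<..b}} \<subseteq>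
          {\<omega> \<in> space M. x \<in> crystal T X Gr u \<omega> \<and> x \<notin> crystal T X Gr a \<omega>}"
      proof safe
        fix \<omega> assume \<omega>: "\<omega> \<in> space M" "?Y \<omega> < \<infinity>" "real_of_ereal (?Y \<omega>) \<in> {a<..b}"
        then obtain r where r: "?Y \<omega> = ereal r" "a < r" "r \<le> b"
          using capture_time_nonneg[of x \<omega>] by (cases "?Y \<omega>") auto
        show "x \<in> crystal T X Gr u \<omega>"
          using r \<open>b < u\<close> by (intro crystal_if_capture_time_less \<omega>(1)) auto
        assume "x \<in> crystal T X Gr a \<omega>"
        from capture_time_le_if_crystal[OF \<omega>(1) this] show False using r by simp
      qed
    qed
    also have "\<dots> \<le> emeasure (intensity M T X) (causal_cone Gr u x - causal_cone Gr a x)"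
      by (rule emeasure_newly_covered_le)
    also have "\<dots> = emeasure (intensity M T X) (causal_cone Gr u x) -
        emeasure (intensity M T X) (causal_cone Gr a x)"
      using fin \<open>a \<le> b\<close> \<open>b < u\<close>
      by (intro emeasure_Diff causal_cone_mono) (auto simp: causal_cone_borel)
    also have "\<dots> = ennreal (F u - F a)"
      using fin by (simp add: F_def emeasure_eq_ennreal_measure ennreal_minus)
    finally have "ennreal (measure (real_law M ?Y) {a<..b}) \<le> ennreal (F u - F a)"
      by (simp add: L.emeasure_eq_measure)
    moreover have "F a \<le> F u"
      unfolding F_def using fin \<open>a \<le> b\<close> \<open>b < u\<close>
      by (intro measure_mono_fmeasurable causal_cone_mono) (auto simp: causal_cone_borel fmeasurable_def less_top)
    ultimately show ?thesis by (simp add: ennreal_le_iff)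
  qed
  \<comment> \<open>As the infimum in the capture time need not be attained, the bound is obtained at \<open>u > b\<close> and
    passes to \<open>b\<close> by continuity of \<open>F\<close>.\<close>
  obtain D where "(F has_real_derivative D) (at b within {0..})"
    using cone_intensity_C1[of x] \<open>0 \<le> b\<close>
    unfolding continuously_differentiable_on_Rplus_def F_def by blast
  then have "(F \<longlongrightarrow> F b) (at b within {0..})"
    using DERIV_continuous continuous_within by blast
  then have "(F \<longlongrightarrow> F b) (at_right b)"
    by (rule tendsto_within_subset) (use \<open>0 \<le> b\<close> in auto)
  then have "((\<lambda>u. F u - F a) \<longlongrightarrow> F b - F a) (at_right b)"
    by (intro tendsto_intros)
  moreover have "\<forall>\<^sub>F u in at_right b. measure (real_law M ?Y) {a<..b} \<le> F u - F a"
    using le by (auto simp: eventually_at_right_field intro: exI[of _ "b + 1"])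
  ultimately have "measure (real_law M ?Y) {a<..b} \<le> F b - F a"
    by (rule tendsto_lowerbound) simp
  then show ?thesis by (simp add: F_def)
qed

lemma absolutely_continuous_capture_law:
  "absolutely_continuous lborel (real_law M (capture_time T X Gr x))"
proof (rule absolutely_continuous_of_locally_Lipschitz_cdf)
  let ?Y = "capture_time T X Gr x"
  show L: "finite_borel_measure (real_law M ?Y)"
    by (intro finite_borel_measure_real_law capture_time_measurable)
  interpret L: finite_borel_measure "real_law M ?Y" by fact
  \<comment> \<open>The Lipschitz bound says nothing about \<open>(-\<infinity>, 0]\<close>, where the law could only have an atom at
    \<open>0\<close>; this is excluded by the cone at time \<open>0\<close>, which is contained in the slice of births at
    time \<open>0\<close>.\<close>
  have "{0} \<in> null_sets (marginal_intensity M T X)"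
    using absolutely_continuous_marginal_intensity unfolding absolutely_continuous_def
    by (rule subsetD) (simp add: null_sets_def)
  then have "emeasure (intensity M T X) (causal_cone Gr 0 x) = 0"
    using emeasure_cone_le[of 0 x] by auto
  then have "measure (real_law M ?Y) {-1<..0} \<le> 0"
    using measure_law_Ioc_le[of "-1" 0 x] by (simp add: causal_cone_neg measure_def)
  then have "emeasure (real_law M ?Y) {-1<..0} = 0"
    by (simp add: L.emeasure_eq_measure measure_le_0_iff)
  moreover have "0 \<le> real_of_ereal (?Y \<omega>)" for \<omega>
    by (intro real_of_ereal_pos capture_time_nonneg)
  then have "-1 < real_of_ereal (?Y \<omega>)" for \<omega>
    by (rule less_le_trans[rotated]) simp
  then have "emeasure (real_law M ?Y) {-1<..0} = emeasure (real_law M ?Y) {..0}"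
    by (simp add: emeasure_real_law[OF capture_time_measurable])
  ultimately show "emeasure (real_law M ?Y) {..0} = 0" by simp
next
  fix n :: nat
  obtain K where "0 \<le> K" "\<And>a b. 0 \<le> a \<Longrightarrow> a \<le> b \<Longrightarrow> b \<le> real n \<Longrightarrow>
      measure (intensity M T X) (causal_cone Gr b x) - measure (intensity M T X) (causal_cone Gr a x)
        \<le> K * (b - a)"
    using continuously_differentiable_on_Rplus_imp_Lipschitz[OF cone_intensity_C1] by blast
  then show "\<exists>K\<ge>0. \<forall>a b. 0 \<le> a \<longrightarrow> a \<le> b \<longrightarrow> b \<le> real n \<longrightarrow>
      measure (real_law M (capture_time T X Gr x)) {a<..b} \<le> K * (b - a)"
    using measure_law_Ioc_le[of _ _ x] by (meson order_trans)
qed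

end

theorem theorem3p3:
  fixes M :: "'w measure"
    and T :: "nat \<Rightarrow> 'w \<Rightarrow> ereal" and X :: "nat \<Rightarrow> 'w \<Rightarrow> real^'n"
    and Q :: "real \<Rightarrow> (real^'n) measure"
    and G :: "real \<Rightarrow> real^'n \<Rightarrow> real" and g0 G0 :: real
    and Gr :: "real \<Rightarrow> real \<Rightarrow> real^'n \<Rightarrow> (real^'n) set"
  assumes "CARD('n) \<ge> 2"
    and "class_G M T X Q G g0 G0 Gr"
  shows "\<forall>x. capture_time T X Gr x \<in> borel_measurable M \<and>
    absolutely_continuous lborel (real_law M (capture_time T X Gr x)) \<and>
    (\<exists>f \<in> borel_measurable borel. (\<forall>t. 0 \<le> f t) \<and>
       real_law M (capture_time T X Gr x) = density lborel (\<lambda>t. ennreal (f t)))"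
proof -
  interpret class_G M T X Q G g0 G0 Gr by fact
  show ?thesis
    using capture_time_measurable absolutely_continuous_capture_law
      ex_real_density[OF finite_borel_measure_real_law[OF capture_time_measurable]]
    by blast
qed

end
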